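(* Let $G$ and $H$ be $3$-connected graphs. Then the lattices of integer flows $\Lambda(G)$ and $\Lambda(H)$ are isometric if and only if $G$ and $H$ are isomorphic.
   Context: Graphs are finite undirected connected multigraphs, and "$3$-connected" is the usual graph-theoretic term. Given a graph $G=(V,E)$, orient each edge arbitrarily and let $D$ be the $V\times E$ signed incidence matrix: $D_{ve}=+1$ if $e$ points into $v$ but not out, $D_{ve}=-1$ if $e$ points out of $v$ but not in, and $D_{ve}=0$ otherwise. The matrix $D$ defines a linear transformation $D:\mathbb{R}^E\to\mathbb{R}^V$. The lattice of integer flows of $G$ is $\Lambda(G)=\ker(D)\cap\mathbb{Z}^E$, a finitely generated free abelian group with the positive definite integer-valued inner product induced by the Euclidean dot product on $\mathbb{R}^E$. Its isometry class does not depend on the orientation chosen. An isometry of lattices $\Lambda,\Lambda'$ is a bijection $\psi:\Lambda\to\Lambda'$ such that both $\psi$ and $\psi^{-1}$ are abelian group homomorphisms that preserve the bilinear forms on the lattices; two lattices are isometric if there is an isometry between them. *)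

theory Defs
  imports "HOL-Analysis.Analysis" "HOL-Library.Uprod"
begin

text \<open>
  A finite multigraph is the map sending each edge to its unordered pair of ends.  The vertices and
  the edges are the elements of the finite types \<^typ>\<open>'v\<close> and \<^typ>\<open>'e\<close>; parallel edges are edges
  with the same image, and a loop has an improper pair \<open>Upair v v\<close> as its image.
\<close>

type_synonym ('v, 'e) multigraph = "'e \<Rightarrow> 'v uprod"

definition isomorphic_graphs :: "('v, 'e) multigraph \<Rightarrow> ('w, 'f) multigraph \<Rightarrow> bool" where
  "isomorphic_graphs G H \<longleftrightarrow>
     (\<exists>(\<alpha> :: 'v \<Rightarrow> 'w) (\<beta> :: 'e \<Rightarrow> 'f). bij \<alpha> \<and> bij \<beta> \<and> (\<forall>e. H (\<beta> e) = map_uprod \<alpha> (G e)))"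

definition induced_connected :: "('v, 'e) multigraph \<Rightarrow> 'v set \<Rightarrow> bool" where
  "induced_connected G W \<longleftrightarrow> W \<noteq> {} \<and>
     (\<forall>u\<in>W. \<forall>v\<in>W. (u, v) \<in> {(a, b). a \<in> W \<and> b \<in> W \<and> (\<exists>e. G e = Upair a b)}\<^sup>*)"

text \<open>
  There are at least four vertices, and deleting at most two of them never disconnects the graph
  (\<open>X = {}\<close> says that the graph itself is connected).  Parallel edges are allowed.  A loop counts as
  a separation at its vertex, so it is excluded.  This clause is essential for flow lattices: a loop
  contributes an orthogonal summand generated by a vector of norm one, regardless of the vertex at
  which it is attached.
\<close>

definition three_connected :: "('v::finite, 'e) multigraph \<Rightarrow> bool" where
  "three_connected G \<longleftrightarrow> CARD('v) > 3 \<and> (\<forall>e. proper_uprod (G e)) \<and>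
     (\<forall>X :: 'v set. card X < 3 \<longrightarrow> induced_connected G (- X))"

text \<open>An orientation gives each edge a pair \<open>(tail, head)\<close>.\<close>

definition orientation_of :: "('e \<Rightarrow> 'v \<times> 'v) \<Rightarrow> ('v, 'e) multigraph \<Rightarrow> bool" where
  "orientation_of \<omega> G \<longleftrightarrow> (\<forall>e. G e = Upair (fst (\<omega> e)) (snd (\<omega> e)))"

lemma orientation_exists: "\<exists>\<omega>. orientation_of \<omega> G"
proof -
  have "\<forall>e. \<exists>p. G e = Upair (fst p) (snd p)"
    by (metis fst_conv snd_conv uprod_exhaust)
  then show ?thesis
    unfolding orientation_of_def by metis
qed

definition incidence_matrix :: "('e::finite \<Rightarrow> 'v \<times> 'v) \<Rightarrow> real ^ 'e ^ 'v::finite" where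
  "incidence_matrix \<omega> = (\<chi> v e.
     if snd (\<omega> e) = v \<and> fst (\<omega> e) \<noteq> v then 1
     else if fst (\<omega> e) = v \<and> snd (\<omega> e) \<noteq> v then - 1
     else 0)"

definition flow_lattice :: "('e::finite \<Rightarrow> 'v::finite \<times> 'v) \<Rightarrow> (real ^ 'e) set" where
  "flow_lattice \<omega> = {x. incidence_matrix \<omega> *v x = 0} \<inter> {x. \<forall>e. x $ e \<in> \<int>}"

text \<open>
  A lattice is an additive subgroup of a real inner product space, with the form inherited from it.
\<close>

definition lattice_morphism ::
    "('a::real_inner \<Rightarrow> 'b::real_inner) \<Rightarrow> 'a set \<Rightarrow> 'b set \<Rightarrow> bool" where
  "lattice_morphism \<psi> L M \<longleftrightarrow> \<psi> \<in> L \<rightarrow> M \<and>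
     (\<forall>x\<in>L. \<forall>y\<in>L. \<psi> (x + y) = \<psi> x + \<psi> y \<and> \<psi> x \<bullet> \<psi> y = x \<bullet> y)"

definition lattice_isometry ::
    "('a::real_inner \<Rightarrow> 'b::real_inner) \<Rightarrow> 'a set \<Rightarrow> 'b set \<Rightarrow> bool" where
  "lattice_isometry \<psi> L M \<longleftrightarrow> bij_betw \<psi> L M \<and>
     lattice_morphism \<psi> L M \<and> lattice_morphism (inv_into L \<psi>) M L"

definition isometric_lattices :: "'a::real_inner set \<Rightarrow> 'b::real_inner set \<Rightarrow> bool" where
  "isometric_lattices L M \<longleftrightarrow> (\<exists>\<psi>. lattice_isometry \<psi> L M)"

end

theory Submission
  imports Defs
begin

text \<open>
Suppose first that an isometry \<open>\<psi>\<close> between the flow lattices is given.  The idea is to recover the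
edges from the metric, and then the vertices from the edges.

\<^emph>\<open>Edges.\<close>  For an integer vector \<open>x\<close> the l1 norm is at most \<open>x \<bullet> x\<close>, with equality exactly when all entries
are 0 or \<open>\<plusminus>1\<close>.  Every integer flow is a sum of flows with such entries whose signs agree with its own
(\<open>conformal_unit_flow\<close>), and over such a sum the l1 norm is additive.  So the l1 norm of a flow is the
least value of \<open>\<Sum>\<^sub>i x\<^sub>i \<bullet> x\<^sub>i\<close> over all ways to write it as a sum of lattice vectors \<open>x\<^sub>i\<close>.  This description
uses nothing but the lattice, hence \<open>\<psi>\<close> preserves the l1 norm (\<open>l1_isometry\<close>).  The l1 norm is piecewise linear, and its
kinks at a flow \<open>u\<close> in direction \<open>v\<close> measure \<open>\<Sum> \<bar>v\<^sub>e\<bar>\<close> over the zeros \<open>e\<close> of \<open>u\<close>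
(\<open>l1_second_difference\<close>).  A 3-connected graph has, for each edge \<open>e\<close>, a flow that vanishes exactly at
\<open>e\<close>; so the kinks at this flow give \<open>\<bar>v\<^sub>e\<bar>\<close> for all \<open>v\<close>.  Comparing both sides,
there is a bijection \<open>\<sigma>\<close> of the edges that carries the supports of flows to the supports of flows
(\<open>isometry_induces_edge_bijection\<close>).

\<^emph>\<open>Vertices.\<close>  This is Whitney's theorem that a 3-connected graph is determined by its cycles; parallel
edges do no harm.  A flow never crosses a cut in exactly one edge, and any set \<open>D\<close> with this property
contains a cut through each of its edges.  In a 3-connected graph
the star of a vertex is a minimal nonempty set of this kind, so \<open>\<sigma>\<close> maps it to a minimal cut.  If that cut is not a star,
then both of its sides contain edges, and the flows avoiding the cut split into flows on the two sides.
Pulled back, this would separate the graph minus a vertex, which is 2-connected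
(\<open>star_image_is_star\<close>).  Thus stars go to stars, and the vertices and their incidences with the edges are recovered
(\<open>whitney_flow_supports\<close>).

Conversely, a graph isomorphism permutes the coordinates of \<open>\<real>\<^sup>E\<close>, with a change of sign where the two
orientations disagree; this is an isometry between the flow lattices.
\<close>

section \<open>Flows, cuts and supports\<close>

abbreviation boundary :: "('e::finite \<Rightarrow> 'v::finite \<times> 'v) \<Rightarrow> real ^ 'e \<Rightarrow> real ^ 'v" where
  "boundary \<omega> x \<equiv> incidence_matrix \<omega> *v x"

definition integer_vector :: "real ^ 'e::finite \<Rightarrow> bool" where
  "integer_vector x \<longleftrightarrow> (\<forall>e. x $ e \<in> \<int>)"

definition support :: "real ^ 'e::finite \<Rightarrow> 'e set" where
  "support x = {e. x $ e \<noteq> 0}"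

definition flow_supports :: "('e::finite \<Rightarrow> 'v::finite \<times> 'v) \<Rightarrow> 'e set set" where
  "flow_supports \<omega> = support ` flow_lattice \<omega>"

definition star :: "('e::finite \<Rightarrow> 'v::finite \<times> 'v) \<Rightarrow> 'v \<Rightarrow> 'e set" where
  "star \<omega> v = {e. v \<in> {fst (\<omega> e), snd (\<omega> e)}}"

definition edge_cut :: "('e::finite \<Rightarrow> 'v::finite \<times> 'v) \<Rightarrow> 'v set \<Rightarrow> 'e set" where
  "edge_cut \<omega> S = {e. (fst (\<omega> e) \<in> S) \<noteq> (snd (\<omega> e) \<in> S)}"

lemma flow_lattice_iff: "x \<in> flow_lattice \<omega> \<longleftrightarrow> boundary \<omega> x = 0 \<and> integer_vector x"
  by (simp add: flow_lattice_def integer_vector_def)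

lemma integer_vector_add: "integer_vector x \<Longrightarrow> integer_vector y \<Longrightarrow> integer_vector (x + y)"
  by (simp add: integer_vector_def)

lemma integer_vector_diff: "integer_vector x \<Longrightarrow> integer_vector y \<Longrightarrow> integer_vector (x - y)"
  by (simp add: integer_vector_def)

lemma integer_vector_axis: "s \<in> \<int> \<Longrightarrow> integer_vector (axis e s)"
  by (simp add: integer_vector_def axis_def)

lemma flow_lattice_zero: "0 \<in> flow_lattice \<omega>"
  by (simp add: flow_lattice_def)

lemma flow_lattice_add:
  "x \<in> flow_lattice \<omega> \<Longrightarrow> y \<in> flow_lattice \<omega> \<Longrightarrow> x + y \<in> flow_lattice \<omega>"
  by (simp add: flow_lattice_iff integer_vector_add matrix_vector_right_distrib)

lemma flow_lattice_diff:
  "x \<in> flow_lattice \<omega> \<Longrightarrow> y \<in> flow_lattice \<omega> \<Longrightarrow> x - y \<in> flow_lattice \<omega>"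
  by (simp add: flow_lattice_iff integer_vector_diff matrix_vector_mult_diff_distrib)

lemma flow_lattice_scale: "x \<in> flow_lattice \<omega> \<Longrightarrow> real k *\<^sub>R x \<in> flow_lattice \<omega>"
  by (simp add: flow_lattice_iff integer_vector_def matrix_vector_mult_scaleR)

lemma boundary_component:
  "boundary \<omega> x $ v = (\<Sum>e\<in>UNIV. (of_bool (snd (\<omega> e) = v) - of_bool (fst (\<omega> e) = v)) * x $ e)"
  unfolding matrix_vector_mult_def incidence_matrix_def
  by (auto intro!: sum.cong)

lemma boundary_axis:
  "boundary \<omega> (axis e s) = s *\<^sub>R (axis (snd (\<omega> e)) 1 - axis (fst (\<omega> e)) 1)"
proof -
  have "boundary \<omega> (axis e s) $ v = (s *\<^sub>R (axis (snd (\<omega> e)) 1 - axis (fst (\<omega> e)) 1)) $ v" for v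
  proof -
    have "boundary \<omega> (axis e s) $ v
        = (\<Sum>i\<in>UNIV. if i = e then (of_bool (snd (\<omega> i) = v) - of_bool (fst (\<omega> i) = v)) * s else 0)"
      unfolding boundary_component by (rule sum.cong) (auto simp: axis_def)
    then show ?thesis
      by (simp add: axis_def)
  qed
  then show ?thesis
    by (simp add: vec_eq_iff)
qed

lemma sum_boundary:
  "(\<Sum>v\<in>S. boundary \<omega> x $ v)
     = (\<Sum>e\<in>UNIV. (of_bool (snd (\<omega> e) \<in> S) - of_bool (fst (\<omega> e) \<in> S)) * x $ e)"
proof -
  have "(\<Sum>v\<in>S. boundary \<omega> x $ v) = (\<Sum>e\<in>UNIV. \<Sum>v\<in>S.
      (of_bool (snd (\<omega> e) = v) - of_bool (fst (\<omega> e) = v)) * x $ e)"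
    unfolding boundary_component by (rule sum.swap)
  also have "\<dots> = (\<Sum>e\<in>UNIV. (of_bool (snd (\<omega> e) \<in> S) - of_bool (fst (\<omega> e) \<in> S)) * x $ e)"
    by (simp add: sum_distrib_right[symmetric] sum_subtractf of_bool_def)
  finally show ?thesis .
qed

text \<open>
Net inflow into a set of vertices comes through its edge cut only.  This is how a flow is prevented from crossing
a cut in a single edge.
\<close>

lemma sum_boundary_edge_cut:
  "(\<Sum>v\<in>S. boundary \<omega> x $ v)
     = (\<Sum>e\<in>support x \<inter> edge_cut \<omega> S. (of_bool (snd (\<omega> e) \<in> S) - of_bool (fst (\<omega> e) \<in> S)) * x $ e)"
  unfolding sum_boundary
  by (rule sum.mono_neutral_right) (auto simp: support_def edge_cut_def)

section \<open>The l1 norm as a lattice invariant\<close>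

text \<open>
Orient the support of the flow along the signs of the flow.  Conservation makes every edge lie on a
directed cycle, because the set of vertices reachable from the head of an edge has no outgoing edges,
hence no incoming ones.  A directed cycle with distinct vertices is the required \<open>c\<close>.
\<close>

lemma conformal_unit_flow:
  fixes \<omega> :: "'e::finite \<Rightarrow> 'v::finite \<times> 'v"
  assumes u: "u \<in> flow_lattice \<omega>" and "u \<noteq> 0"
  obtains c where "c \<in> flow_lattice \<omega>" "c \<noteq> 0" "\<And>e. c $ e = 0 \<or> c $ e = sgn (u $ e)"
proof -
  obtain e0 where e0: "u $ e0 \<noteq> 0"
    using \<open>u \<noteq> 0\<close> by (auto simp: vec_eq_iff)
  define tl where "tl e = (if u $ e > 0 then fst (\<omega> e) else snd (\<omega> e))" for e
  define hd where "hd e = (if u $ e > 0 then snd (\<omega> e) else fst (\<omega> e))" for e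
  define b where "b = hd e0"
  \<comment> \<open>Requiring heads in \<open>T - {b}\<close> keeps a path from using an edge twice: each new edge ends in a new vertex.\<close>
  define path where "path T z c \<longleftrightarrow> boundary \<omega> c = axis z 1 - axis b 1 \<and>
      (\<forall>e. c $ e = 0 \<or> (c $ e = sgn (u $ e) \<and> hd e \<in> T - {b}))" for T z c
  define good where "good T \<longleftrightarrow> b \<in> T \<and> (\<forall>z\<in>T. \<exists>c. path T z c)" for T
  have bd: "boundary \<omega> (axis e (sgn (u $ e))) = axis (hd e) 1 - axis (tl e) 1" if "u $ e \<noteq> 0" for e
    using that by (simp add: boundary_axis hd_def tl_def sgn_if)
  have "good {b}"
    unfolding good_def path_def by (auto intro!: exI[of _ 0])
  \<comment> \<open>A largest good set plays the role of the set of all vertices reachable from \<open>b\<close>.\<close>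
  then obtain T where T: "good T" and max: "\<And>T'. good T' \<Longrightarrow> card T' \<le> card T"
    using ex_has_greatest_nat[of good "{b}" card "Suc CARD('v)"]
    by (metis card_mono finite subset_UNIV le_imp_less_Suc)
  have closed: "hd e \<in> T" if e: "u $ e \<noteq> 0" and tl: "tl e \<in> T" for e
  proof (rule ccontr)
    assume new: "hd e \<notin> T"
    obtain c where c: "path T (tl e) c"
      using T tl by (auto simp: good_def)
    then have ce: "c $ e = 0"
      using new by (auto simp: path_def)
    have "path (insert (hd e) T) (hd e) (c + axis e (sgn (u $ e)))"
      using c ce new T bd[OF e]
      by (auto simp: path_def matrix_vector_right_distrib axis_def good_def)
    moreover have "path (insert (hd e) T) z d" if "path T z d" for z d
      using that by (auto simp: path_def)
    ultimately have "good (insert (hd e) T)"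
      using T unfolding good_def by blast
    from max[OF this] new show False
      by simp
  qed
  \<comment> \<open>As no edge leaves \<open>T\<close>, every term of the net inflow of \<open>u\<close> into \<open>T\<close> is nonnegative; their sum is 0.\<close>
  let ?t = "\<lambda>e. (of_bool (snd (\<omega> e) \<in> T) - of_bool (fst (\<omega> e) \<in> T)) * u $ e"
  have "(\<Sum>e\<in>UNIV. ?t e) = 0"
    using u by (simp add: sum_boundary[symmetric] flow_lattice_iff)
  moreover have "?t e \<ge> 0" for e
    using closed[of e] by (cases "u $ e" "0::real" rule: linorder_cases) (auto simp: hd_def tl_def)
  ultimately have "?t e0 = 0"
    by (simp add: sum_nonneg_eq_0_iff)
  moreover have "hd e0 \<in> T"
    using T by (simp add: good_def b_def)
  ultimately have "tl e0 \<in> T"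
    using e0 by (auto simp: hd_def tl_def split: if_splits)
  then obtain c where c: "path T (tl e0) c"
    using T by (auto simp: good_def)
  then have ce0: "c $ e0 = 0"
    by (auto simp: path_def b_def)
  \<comment> \<open>The path from \<open>b\<close> back to the tail of \<open>e0\<close> is closed up by \<open>e0\<close> itself.\<close>
  let ?c = "c + axis e0 (sgn (u $ e0))"
  have vals: "?c $ e = 0 \<or> ?c $ e = sgn (u $ e)" for e
    using c ce0 by (auto simp: path_def axis_def)
  have "boundary \<omega> ?c = 0"
    using c bd[OF e0] by (simp add: path_def matrix_vector_right_distrib b_def)
  moreover have "integer_vector ?c"
    unfolding integer_vector_def using vals by (metis Ints_0 Ints_1 Ints_minus sgn_if)
  moreover have "?c \<noteq> 0"
    using ce0 e0 by (auto simp: vec_eq_iff axis_def sgn_if intro!: exI[of _ e0])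
  ultimately show ?thesis
    using vals that by (auto simp: flow_lattice_iff)
qed

definition l1_norm :: "real ^ 'e::finite \<Rightarrow> real" where
  "l1_norm x = (\<Sum>e\<in>UNIV. \<bar>x $ e\<bar>)"

lemma l1_triangle: "l1_norm (x + y) \<le> l1_norm x + l1_norm y"
  unfolding l1_norm_def sum.distrib[symmetric] by (rule sum_mono) simp

lemma component_le_l1_norm: "\<bar>x $ e\<bar> \<le> l1_norm x"
  unfolding l1_norm_def by (rule member_le_sum) auto

lemma l1_le_inner_self: "integer_vector x \<Longrightarrow> l1_norm x \<le> x \<bullet> x"
proof -
  assume x: "integer_vector x"
  have "\<bar>x $ e\<bar> \<le> x $ e * x $ e" for e
  proof (cases "x $ e = 0")
    case False
    then have "1 \<le> \<bar>x $ e\<bar>"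
      using x Ints_nonzero_abs_ge1 by (auto simp: integer_vector_def)
    then have "\<bar>x $ e\<bar> * 1 \<le> \<bar>x $ e\<bar> * \<bar>x $ e\<bar>"
      by (intro mult_left_mono) auto
    then show ?thesis by simp
  qed simp
  then show ?thesis
    by (simp add: l1_norm_def inner_vec_def sum_mono)
qed

lemma lattice_morphism_zero:
  assumes "lattice_morphism \<psi> L M" "0 \<in> L"
  shows "\<psi> 0 = 0"
proof -
  have "\<psi> (0 + 0) = \<psi> 0 + \<psi> 0"
    using assms unfolding lattice_morphism_def by blast
  then show ?thesis by simp
qed

text \<open>
Split off a conformal unit flow \<open>c\<close>, for which the l1 norm and the squared length agree.  The morphism keeps
the squared length of \<open>c\<close>, which bounds the l1 norm of its image; the rest follows by induction and the triangle
inequality.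
\<close>

lemma l1_morphism_le:
  assumes m: "lattice_morphism \<psi> (flow_lattice \<omega>) (flow_lattice \<eta>)"
    and u: "u \<in> flow_lattice \<omega>"
  shows "l1_norm (\<psi> u) \<le> l1_norm u"
proof -
  \<comment> \<open>The norm of an integer vector drops by at least 1 in each step, so a natural bound on it is a measure for induction.\<close>
  have "l1_norm (\<psi> u) \<le> l1_norm u" if "u \<in> flow_lattice \<omega>" "l1_norm u \<le> real n" for n u
    using that
  proof (induction n arbitrary: u)
    case 0
    have "u $ e = 0" for e
      using component_le_l1_norm[of u e] 0 by simp
    then have "u = 0"
      by (simp add: vec_eq_iff)
    then show ?case
      using lattice_morphism_zero[OF m flow_lattice_zero] by (simp add: l1_norm_def)
  next
    case (Suc n)
    show ?case
    proof (cases "u = 0")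
      case True
      then show ?thesis
        using lattice_morphism_zero[OF m flow_lattice_zero] by (simp add: l1_norm_def)
    next
      case False
      then obtain c where c: "c \<in> flow_lattice \<omega>" "c \<noteq> 0" and vals: "\<And>e. c $ e = 0 \<or> c $ e = sgn (u $ e)"
        using conformal_unit_flow Suc.prems(1) by metis
      have uc: "u - c \<in> flow_lattice \<omega>"
        using Suc.prems c flow_lattice_diff by blast
      have "\<bar>u $ e\<bar> = \<bar>c $ e\<bar> + \<bar>(u - c) $ e\<bar>" for e
      proof (cases "c $ e = 0 \<or> u $ e = 0")
        case True
        then show ?thesis using vals[of e] by auto
      next
        case False
        moreover have "u $ e \<in> \<int>"
          using Suc.prems by (simp add: flow_lattice_iff integer_vector_def)
        ultimately have "1 \<le> \<bar>u $ e\<bar>"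
          using Ints_nonzero_abs_ge1 by blast
        then show ?thesis
          using vals[of e] False by (auto simp: sgn_if split: if_splits)
      qed
      then have split: "l1_norm u = l1_norm c + l1_norm (u - c)"
        unfolding l1_norm_def sum.distrib[symmetric] by (intro sum.cong) auto
      have "c $ e * c $ e = \<bar>c $ e\<bar>" for e
        using vals[of e] by (auto simp: sgn_if)
      then have cc: "c \<bullet> c = l1_norm c"
        by (simp add: l1_norm_def inner_vec_def)
      obtain e where e: "c $ e \<noteq> 0"
        using c(2) by (auto simp: vec_eq_iff)
      then have "1 \<le> \<bar>c $ e\<bar>"
        using vals[of e] by (auto simp: sgn_if)
      then have "l1_norm (u - c) \<le> real n"
        using component_le_l1_norm[of c e] split Suc.prems by simp
      then have IH: "l1_norm (\<psi> (u - c)) \<le> l1_norm (u - c)"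
        using Suc.IH uc by blast
      have "\<psi> (c + (u - c)) = \<psi> c + \<psi> (u - c)"
        using m c uc unfolding lattice_morphism_def by blast
      then have "l1_norm (\<psi> u) \<le> l1_norm (\<psi> c) + l1_norm (\<psi> (u - c))"
        using l1_triangle[of "\<psi> c" "\<psi> (u - c)"] by simp
      also have "l1_norm (\<psi> c) \<le> \<psi> c \<bullet> \<psi> c"
        using m c by (intro l1_le_inner_self) (auto simp: lattice_morphism_def flow_lattice_iff)
      also have "\<psi> c \<bullet> \<psi> c = l1_norm c"
        using m c cc by (simp add: lattice_morphism_def)
      finally show ?thesis
        using IH split by simp
    qed
  qed
  moreover have "l1_norm u \<le> real (nat \<lceil>l1_norm u\<rceil>)"
    by linarith
  ultimately show ?thesis
    using u by blast
qed

lemma lattice_isometry_inv_into: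
  assumes i: "lattice_isometry \<psi> L M" and add: "\<And>x y. x \<in> L \<Longrightarrow> y \<in> L \<Longrightarrow> x + y \<in> L"
  shows "lattice_isometry (inv_into L \<psi>) M L"
proof -
  have b: "bij_betw \<psi> L M" and m: "lattice_morphism \<psi> L M"
    using i by (simp_all add: lattice_isometry_def)
  have eq: "inv_into M (inv_into L \<psi>) x = \<psi> x" if "x \<in> L" for x
    using b that by (rule inv_into_inv_into_eq)
  have "lattice_morphism (inv_into M (inv_into L \<psi>)) L M"
    using m by (simp add: lattice_morphism_def Pi_iff eq add)
  then show ?thesis
    using i bij_betw_inv_into[OF b] by (simp add: lattice_isometry_def)
qed

lemma l1_isometry:
  assumes i: "lattice_isometry \<psi> (flow_lattice \<omega>) (flow_lattice \<eta>)"
    and u: "u \<in> flow_lattice \<omega>"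
  shows "l1_norm (\<psi> u) = l1_norm u"
proof (rule antisym)
  show "l1_norm (\<psi> u) \<le> l1_norm u"
    using i u l1_morphism_le by (auto simp: lattice_isometry_def)
  have b: "bij_betw \<psi> (flow_lattice \<omega>) (flow_lattice \<eta>)"
    using i by (simp add: lattice_isometry_def)
  have "l1_norm (inv_into (flow_lattice \<omega>) \<psi> (\<psi> u)) \<le> l1_norm (\<psi> u)"
    using i u b by (intro l1_morphism_le) (auto simp: lattice_isometry_def bij_betw_apply)
  then show "l1_norm u \<le> l1_norm (\<psi> u)"
    using bij_betw_inv_into_left[OF b u] by simp
qed

lemma lattice_morphism_scale:
  assumes m: "lattice_morphism \<psi> (flow_lattice \<omega>) M" and u: "u \<in> flow_lattice \<omega>"
  shows "\<psi> (real k *\<^sub>R u) = real k *\<^sub>R \<psi> u"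
proof (induction k)
  case 0
  then show ?case
    using lattice_morphism_zero[OF m flow_lattice_zero] by simp
next
  case (Suc k)
  have "\<psi> (real k *\<^sub>R u + u) = \<psi> (real k *\<^sub>R u) + \<psi> u"
    using m u flow_lattice_scale[OF u] unfolding lattice_morphism_def by blast
  then show ?case
    using Suc by (simp add: algebra_simps)
qed

lemma lattice_morphism_diff:
  assumes m: "lattice_morphism \<psi> (flow_lattice \<omega>) M"
    and "u \<in> flow_lattice \<omega>" "v \<in> flow_lattice \<omega>"
  shows "\<psi> (u - v) = \<psi> u - \<psi> v"
proof -
  have "\<psi> ((u - v) + v) = \<psi> (u - v) + \<psi> v"
    using m assms(2,3) flow_lattice_diff[OF assms(2,3)] unfolding lattice_morphism_def by blast
  then show ?thesis by simp
qed

text \<open>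
Where \<open>u\<close> is nonzero, \<open>t \<mapsto> \<bar>k u\<^sub>e + t v\<^sub>e\<bar>\<close> is linear for \<open>\<bar>t\<bar> \<le> 1\<close> as soon as \<open>k\<close> dominates \<open>v\<close>, so only the zeros
of \<open>u\<close> contribute to the second difference.
\<close>

lemma l1_second_difference:
  assumes u: "integer_vector u" and k: "real k \<ge> l1_norm v"
  shows "l1_norm (real k *\<^sub>R u + v) + l1_norm (real k *\<^sub>R u - v) - 2 * l1_norm (real k *\<^sub>R u)
    = 2 * (\<Sum>e\<in>- support u. \<bar>v $ e\<bar>)"
proof -
  have "\<bar>real k * u $ e + v $ e\<bar> + \<bar>real k * u $ e - v $ e\<bar> - 2 * \<bar>real k * u $ e\<bar>
    = (if e \<in> - support u then 2 * \<bar>v $ e\<bar> else 0)" for e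
  proof (cases "u $ e = 0")
    case False
    then have "1 \<le> \<bar>u $ e\<bar>"
      using u Ints_nonzero_abs_ge1 by (auto simp: integer_vector_def)
    then have "real k * 1 \<le> real k * \<bar>u $ e\<bar>"
      by (intro mult_left_mono) auto
    then have "\<bar>v $ e\<bar> \<le> \<bar>real k * u $ e\<bar>"
      using component_le_l1_norm[of v e] k by (simp add: abs_mult)
    then show ?thesis
      using False by (auto simp: support_def)
  qed (simp add: support_def)
  then show ?thesis
    by (simp add: l1_norm_def sum_distrib_left sum.distrib[symmetric] sum_subtractf[symmetric]
        sum.If_cases Compl_eq)
qed

lemma isometry_zero_set_sum:
  assumes i: "lattice_isometry \<psi> (flow_lattice \<omega>) (flow_lattice \<eta>)"
    and u: "u \<in> flow_lattice \<omega>" and v: "v \<in> flow_lattice \<omega>"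
  shows "(\<Sum>f\<in>- support (\<psi> u). \<bar>\<psi> v $ f\<bar>) = (\<Sum>e\<in>- support u. \<bar>v $ e\<bar>)"
proof -
  have m: "lattice_morphism \<psi> (flow_lattice \<omega>) (flow_lattice \<eta>)"
    using i by (simp add: lattice_isometry_def)
  have add: "\<psi> (x + y) = \<psi> x + \<psi> y" if "x \<in> flow_lattice \<omega>" "y \<in> flow_lattice \<omega>" for x y
    using m that by (simp add: lattice_morphism_def)
  define k where "k = nat \<lceil>l1_norm v\<rceil>"
  have k: "real k \<ge> l1_norm v"
    unfolding k_def by linarith
  have ku: "real k *\<^sub>R u \<in> flow_lattice \<omega>"
    using u by (rule flow_lattice_scale)
  have k': "real k \<ge> l1_norm (\<psi> v)"
    using k l1_isometry[OF i v] by simp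
  have "\<psi> u \<in> flow_lattice \<eta>"
    using m u by (auto simp: lattice_morphism_def)
  then have "2 * (\<Sum>f\<in>- support (\<psi> u). \<bar>\<psi> v $ f\<bar>)
      = l1_norm (\<psi> (real k *\<^sub>R u + v)) + l1_norm (\<psi> (real k *\<^sub>R u - v)) - 2 * l1_norm (\<psi> (real k *\<^sub>R u))"
    using l1_second_difference[OF _ k', of "\<psi> u"]
    by (simp add: add[OF ku v] lattice_morphism_diff[OF m ku v] lattice_morphism_scale[OF m u]
        flow_lattice_iff)
  also have "\<dots> = 2 * (\<Sum>e\<in>- support u. \<bar>v $ e\<bar>)"
    using l1_second_difference[OF _ k, of u] u
      l1_isometry[OF i flow_lattice_add[OF ku v]] l1_isometry[OF i flow_lattice_diff[OF ku v]]
      l1_isometry[OF i ku]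
    by (simp add: flow_lattice_iff)
  finally show ?thesis by simp
qed


text \<open>
A large multiple of one flow cannot be cancelled by the other.
\<close>

lemma flow_supports_Un:
  assumes "X \<in> flow_supports \<omega>" "Y \<in> flow_supports \<omega>"
  shows "X \<union> Y \<in> flow_supports \<omega>"
proof -
  obtain u v where u: "u \<in> flow_lattice \<omega>" "X = support u" and v: "v \<in> flow_lattice \<omega>" "Y = support v"
    using assms by (auto simp: flow_supports_def)
  define k where "k = nat \<lceil>l1_norm v\<rceil> + 1"
  have k: "real k > l1_norm v"
    unfolding k_def by linarith
  have "real k * u $ e + v $ e \<noteq> 0" if "u $ e \<noteq> 0" for e
  proof -
    have "1 \<le> \<bar>u $ e\<bar>"
      using u that Ints_nonzero_abs_ge1 by (auto simp: flow_lattice_iff integer_vector_def)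
    then have "real k * 1 \<le> real k * \<bar>u $ e\<bar>"
      by (intro mult_left_mono) auto
    then have "\<bar>v $ e\<bar> < \<bar>real k * u $ e\<bar>"
      using component_le_l1_norm[of v e] k by (simp add: abs_mult)
    then show ?thesis by linarith
  qed
  then have "e \<in> support (real k *\<^sub>R u + v) \<longleftrightarrow> e \<in> X \<union> Y" for e
    by (cases "u $ e = 0") (simp_all add: u v support_def)
  then have "support (real k *\<^sub>R u + v) = X \<union> Y"
    by blast
  moreover have "real k *\<^sub>R u + v \<in> flow_lattice \<omega>"
    using u v by (simp add: flow_lattice_add flow_lattice_scale)
  ultimately show ?thesis
    by (auto simp: flow_supports_def)
qed

text \<open>
The absolute value of the coordinate \<open>e\<close> is the sum over the zero set of a flow vanishing only at \<open>e\<close>.  The image of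
this flow might vanish on more than one edge; choosing one of these, \<open>f\<close>, and a flow of the other graph that vanishes
only at \<open>f\<close>, one sees that its preimage can vanish only at \<open>e\<close>.
\<close>

lemma isometry_preserves_coordinate:
  assumes i: "lattice_isometry \<psi> (flow_lattice \<omega>) (flow_lattice \<eta>)"
    and E: "- {e} \<in> flow_supports \<omega>" "UNIV \<in> flow_supports \<omega>"
    and F: "\<And>f. - {f} \<in> flow_supports \<eta>"
  obtains f where "\<And>x. x \<in> flow_lattice \<omega> \<Longrightarrow> \<bar>\<psi> x $ f\<bar> = \<bar>x $ e\<bar>"
proof -
  have b: "bij_betw \<psi> (flow_lattice \<omega>) (flow_lattice \<eta>)"
    using i by (simp add: lattice_isometry_def)
  obtain u where u: "u \<in> flow_lattice \<omega>" "- support u = {e}"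
    using E(1) by (metis double_complement flow_supports_def imageE)
  obtain v where v: "v \<in> flow_lattice \<omega>" "support v = UNIV"
    using E(2) by (auto simp: flow_supports_def)
  have "(\<Sum>f\<in>- support (\<psi> u). \<bar>\<psi> v $ f\<bar>) \<noteq> 0"
    using isometry_zero_set_sum[OF i u(1) v(1)] u(2) v(2) by (auto simp: support_def)
  then obtain f where f: "f \<in> - support (\<psi> u)" "\<psi> v $ f \<noteq> 0"
    by (metis (mono_tags, lifting) abs_zero sum.neutral)
  obtain w' where w': "w' \<in> flow_lattice \<eta>" "- support w' = {f}"
    using F[of f] by (metis double_complement flow_supports_def imageE)
  then obtain w where w: "w \<in> flow_lattice \<omega>" "- support (\<psi> w) = {f}"
    using b by (metis bij_betw_imp_surj_on imageE)
  have sum_w: "\<bar>\<psi> x $ f\<bar> = (\<Sum>a\<in>- support w. \<bar>x $ a\<bar>)" if "x \<in> flow_lattice \<omega>" for x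
    using isometry_zero_set_sum[OF i w(1) that] w(2) by simp
  have "(\<Sum>a\<in>- support w. \<bar>u $ a\<bar>) = 0"
    using sum_w[OF u(1)] f(1) by (simp add: support_def)
  then have "- support w \<subseteq> - support u"
    by (auto simp: sum_nonneg_eq_0_iff support_def)
  moreover have "- support w \<noteq> {}"
    using sum_w[OF v(1)] f(2) by auto
  ultimately have "- support w = {e}"
    using u(2) by auto
  then have "\<bar>\<psi> x $ f\<bar> = \<bar>x $ e\<bar>" if "x \<in> flow_lattice \<omega>" for x
    using sum_w[OF that] by simp
  then show ?thesis
    by (rule that)
qed

lemma isometry_induces_edge_bijection:
  fixes \<omega> :: "'e::finite \<Rightarrow> 'v::finite \<times> 'v" and \<eta> :: "'f::finite \<Rightarrow> 'w::finite \<times> 'w"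
  assumes i: "lattice_isometry \<psi> (flow_lattice \<omega>) (flow_lattice \<eta>)"
    and E: "\<And>e. - {e} \<in> flow_supports \<omega>" "UNIV \<in> flow_supports \<omega>"
    and F: "\<And>f. - {f} \<in> flow_supports \<eta>" "UNIV \<in> flow_supports \<eta>"
  obtains \<sigma> where "bij \<sigma>" "\<And>X. \<sigma> ` X \<in> flow_supports \<eta> \<longleftrightarrow> X \<in> flow_supports \<omega>"
proof -
  have b: "bij_betw \<psi> (flow_lattice \<omega>) (flow_lattice \<eta>)"
    using i by (simp add: lattice_isometry_def)
  have separate: "e = e'" if "\<And>x. x \<in> flow_lattice \<omega> \<Longrightarrow> \<bar>x $ e\<bar> = \<bar>x $ e'\<bar>" for e e'
  proof -
    obtain u where u: "u \<in> flow_lattice \<omega>" "- support u = {e}"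
      using E(1)[of e] by (metis double_complement flow_supports_def imageE)
    have "e \<in> - support u"
      by (simp add: u(2))
    then have "u $ e' = 0"
      using that[OF u(1)] by (simp add: support_def)
    then have "e' \<in> - support u"
      by (simp add: support_def)
    then show ?thesis
      using u(2) by simp
  qed
  have "\<exists>f. \<forall>x\<in>flow_lattice \<omega>. \<bar>\<psi> x $ f\<bar> = \<bar>x $ e\<bar>" for e
    using isometry_preserves_coordinate[OF i E(1,2) F(1)] by metis
  then obtain \<sigma> where \<sigma>: "\<And>e x. x \<in> flow_lattice \<omega> \<Longrightarrow> \<bar>\<psi> x $ \<sigma> e\<bar> = \<bar>x $ e\<bar>"
    by metis
  have "inj \<sigma>"
    by (rule injI) (metis \<sigma> separate)
  define \<phi> where "\<phi> = inv_into (flow_lattice \<omega>) \<psi>"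
  have i': "lattice_isometry \<phi> (flow_lattice \<eta>) (flow_lattice \<omega>)"
    unfolding \<phi>_def using i flow_lattice_add by (rule lattice_isometry_inv_into)
  have "\<exists>e. \<forall>y\<in>flow_lattice \<eta>. \<bar>\<phi> y $ e\<bar> = \<bar>y $ f\<bar>" for f
    using isometry_preserves_coordinate[OF i' F(1,2) E(1)] by metis
  then have "\<exists>e. \<sigma> e = f" for f
  proof -
    obtain e where e: "\<And>y. y \<in> flow_lattice \<eta> \<Longrightarrow> \<bar>\<phi> y $ e\<bar> = \<bar>y $ f\<bar>"
      using \<open>\<exists>e. \<forall>y\<in>flow_lattice \<eta>. \<bar>\<phi> y $ e\<bar> = \<bar>y $ f\<bar>\<close> by metis
    obtain w' where w': "w' \<in> flow_lattice \<eta>" "- support w' = {f}"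
      using F(1)[of f] by (metis double_complement flow_supports_def imageE)
    have "\<phi> w' \<in> flow_lattice \<omega>" "\<psi> (\<phi> w') = w'"
      unfolding \<phi>_def using b w'(1) by (auto simp: bij_betw_def inv_into_into f_inv_into_f)
    then have abs: "\<bar>w' $ \<sigma> e\<bar> = \<bar>w' $ f\<bar>"
      using \<sigma>[of "\<phi> w'" e] e[OF w'(1)] by simp
    have "f \<in> - support w'"
      by (simp add: w'(2))
    then have "\<sigma> e \<in> - support w'"
      using abs by (simp add: support_def)
    then show ?thesis
      using w'(2) by auto
  qed
  then have bij: "bij \<sigma>"
    using \<open>inj \<sigma>\<close> by (metis bijI surj_def)
  have supp: "support (\<psi> x) = \<sigma> ` support x" if "x \<in> flow_lattice \<omega>" for x
  proof -
    have "\<sigma> e \<in> support (\<psi> x) \<longleftrightarrow> e \<in> support x" for e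
      using \<sigma>[OF that, of e] by (auto simp: support_def)
    then have "support x = \<sigma> -` support (\<psi> x)"
      by auto
    then show ?thesis
      using bij by (simp add: surj_image_vimage_eq bij_is_surj)
  qed
  have "flow_supports \<eta> = (\<lambda>X. \<sigma> ` X) ` flow_supports \<omega>"
  proof -
    have "flow_supports \<eta> = support ` \<psi> ` flow_lattice \<omega>"
      using b by (simp add: flow_supports_def bij_betw_def)
    then show ?thesis
      using supp by (auto simp: flow_supports_def image_image)
  qed
  then have "\<sigma> ` X \<in> flow_supports \<eta> \<longleftrightarrow> X \<in> flow_supports \<omega>" for X
    using bij by (auto simp: inj_image_eq_iff bij_is_inj)
  then show ?thesis
    using bij that by blast
qed


section \<open>Circuits in 3-connected graphs\<close>

lemma star_eq_edge_cut:
  assumes "\<And>e. fst (\<omega> e) \<noteq> snd (\<omega> e)"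
  shows "star \<omega> v = edge_cut \<omega> {v}"
  using assms by (auto simp: star_def edge_cut_def) metis+

text \<open>
Walks are represented by their signed edge counts; only the boundary and the vertices that are avoided matter
later, so no walk needs to be a path.
\<close>

lemma route:
  assumes tc: "three_connected G" and or: "orientation_of \<omega> G"
    and X: "card X < 3" "a \<notin> X" "b \<notin> X"
  obtains r where "integer_vector r" "boundary \<omega> r = axis b 1 - axis a 1"
    "\<forall>e\<in>support r. fst (\<omega> e) \<notin> X \<and> snd (\<omega> e) \<notin> X"
proof -
  let ?good = "\<lambda>z r. integer_vector r \<and> boundary \<omega> r = axis z 1 - axis a 1
    \<and> (\<forall>e\<in>support r. fst (\<omega> e) \<notin> X \<and> snd (\<omega> e) \<notin> X)"
  have "induced_connected G (- X)"
    using tc X(1) by (simp add: three_connected_def)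
  then have "(a, b) \<in> {(a, b). a \<in> - X \<and> b \<in> - X \<and> (\<exists>e. G e = Upair a b)}\<^sup>*"
    using X by (simp add: induced_connected_def)
  then have "\<exists>r. ?good b r"
  proof (induction rule: rtrancl_induct)
    case base
    show ?case
      by (rule exI[of _ 0]) (simp add: integer_vector_def support_def)
  next
    case (step y z)
    then obtain r where r: "?good y r"
      by blast
    from step obtain e where e: "G e = Upair y z" and yz: "y \<notin> X" "z \<notin> X"
      by auto
    then have cases: "fst (\<omega> e) = y \<and> snd (\<omega> e) = z \<or> fst (\<omega> e) = z \<and> snd (\<omega> e) = y"
      using or by (auto simp: orientation_of_def)
    define s :: real where "s = (if fst (\<omega> e) = y then 1 else - 1)"
    have "boundary \<omega> (axis e s) = axis z 1 - axis y 1"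
      using cases by (auto simp: boundary_axis s_def)
    moreover have "integer_vector (axis e s)"
      by (simp add: integer_vector_axis s_def)
    moreover have "support (r + axis e s) \<subseteq> insert e (support r)"
      by (auto simp: support_def axis_def split: if_splits)
    ultimately have "?good z (r + axis e s)"
      using r cases yz by (auto simp: integer_vector_add matrix_vector_right_distrib)
    then show ?case by blast
  qed
  then show ?thesis
    using that by blast
qed

lemma loopless:
  assumes "three_connected G" "orientation_of \<omega> G"
  shows "fst (\<omega> e) \<noteq> snd (\<omega> e)"
  using assms unfolding three_connected_def orientation_of_def
  by (metis proper_uprod_simps)

lemma vertex_outside:
  fixes G :: "('v::finite, 'e) multigraph"
  assumes "three_connected G" "card X \<le> 3"
  obtains z :: 'v where "z \<notin> X"
proof -
  have "card X < CARD('v)"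
    using assms by (simp add: three_connected_def)
  then have "X \<noteq> UNIV"
    by auto
  then show ?thesis
    using that by blast
qed

text \<open>
A 3-connected graph has no edge cut of size at most two.  To go around \<open>f = ab\<close> without using \<open>e\<close>, choose an end
\<open>x\<close> of \<open>e\<close> different from \<open>a\<close> and \<open>b\<close>, and a vertex \<open>c\<close> outside \<open>{a, b, x}\<close>.  A walk from \<open>b\<close> to \<open>c\<close> that avoids \<open>a\<close>
and \<open>x\<close>, followed by one from \<open>c\<close> to \<open>a\<close> that avoids \<open>b\<close> and \<open>x\<close>, uses neither edge.  If \<open>e\<close> is parallel to \<open>f\<close>,
any \<open>x\<close> other than \<open>a\<close> and \<open>b\<close> will do.
\<close>

lemma single_deletion_flow:
  assumes tc: "three_connected G" and or: "orientation_of \<omega> G" and "e \<noteq> f"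
  obtains X where "X \<in> flow_supports \<omega>" "f \<in> X" "e \<notin> X"
proof -
  define a b where "a = fst (\<omega> f)" and "b = snd (\<omega> f)"
  have "a \<noteq> b"
    unfolding a_def b_def using tc or by (rule loopless)
  obtain x where x: "x \<notin> {a, b}" "{fst (\<omega> e), snd (\<omega> e)} \<subseteq> {a, b} \<or> x \<in> {fst (\<omega> e), snd (\<omega> e)}"
  proof (cases "{fst (\<omega> e), snd (\<omega> e)} \<subseteq> {a, b}")
    case True
    have "card {a, b} \<le> 3"
      by (simp add: card_insert_if)
    then obtain x where "x \<notin> {a, b}"
      by (rule vertex_outside[OF tc])
    then show ?thesis
      using True that by blast
  next
    case False
    then show ?thesis using that by blast
  qed
  have "card {a, b, x} \<le> 3"
    by (simp add: card_insert_if)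
  then obtain c where c: "c \<notin> {a, b, x}"
    by (rule vertex_outside[OF tc])
  have small: "card {a, x} < 3" "card {b, x} < 3"
    by (simp_all add: card_insert_if)
  have av: "b \<notin> {a, x}" "c \<notin> {a, x}" "c \<notin> {b, x}" "a \<notin> {b, x}"
    using c x(1) \<open>a \<noteq> b\<close> by auto
  obtain r where r: "integer_vector r" "boundary \<omega> r = axis c 1 - axis b 1"
    "\<forall>g\<in>support r. fst (\<omega> g) \<notin> {a, x} \<and> snd (\<omega> g) \<notin> {a, x}"
    by (rule route[OF tc or small(1) av(1,2)])
  obtain q where q: "integer_vector q" "boundary \<omega> q = axis a 1 - axis c 1"
    "\<forall>g\<in>support q. fst (\<omega> g) \<notin> {b, x} \<and> snd (\<omega> g) \<notin> {b, x}"
    by (rule route[OF tc or small(2) av(3,4)])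
  have "e \<notin> support r" "e \<notin> support q" "f \<notin> support r" "f \<notin> support q"
    using r(3) q(3) x(2) loopless[OF tc or, of e]
    by (auto simp: a_def b_def)
  then have "f \<in> support (r + q + axis f 1)" "e \<notin> support (r + q + axis f 1)"
    using \<open>e \<noteq> f\<close> by (auto simp: support_def axis_def)
  moreover have "r + q + axis f 1 \<in> flow_lattice \<omega>"
    using r q by (simp add: flow_lattice_iff integer_vector_add integer_vector_axis
        matrix_vector_right_distrib boundary_axis a_def b_def)
  ultimately show ?thesis
    using that by (auto simp: flow_supports_def)
qed

text \<open>
Take the union of the supports of flows that avoid \<open>e\<close>, one through each other edge.
\<close>

lemma complement_singleton_is_flow_support:
  assumes tc: "three_connected G" and or: "orientation_of \<omega> G"
  shows "- {e} \<in> flow_supports \<omega>"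
proof -
  have "\<exists>X\<in>flow_supports \<omega>. S \<subseteq> X \<and> e \<notin> X" if "e \<notin> S" for S
    using finite[of S] that
  proof (induction S)
    case empty
    have "support 0 \<in> flow_supports \<omega>"
      using flow_lattice_zero by (auto simp: flow_supports_def)
    then show ?case by (auto simp: support_def)
  next
    case (insert f S)
    then obtain X where X: "X \<in> flow_supports \<omega>" "S \<subseteq> X" "e \<notin> X"
      by blast
    have "e \<noteq> f"
      using insert.prems by auto
    then obtain Y where Y: "Y \<in> flow_supports \<omega>" "f \<in> Y" "e \<notin> Y"
      by (rule single_deletion_flow[OF tc or])
    have "X \<union> Y \<in> flow_supports \<omega>"
      using X(1) Y(1) by (rule flow_supports_Un)
    moreover have "insert f S \<subseteq> X \<union> Y" "e \<notin> X \<union> Y"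
      using X Y by auto
    ultimately show ?case
      by blast
  qed
  from this[of "- {e}"] obtain X where "X \<in> flow_supports \<omega>" "- {e} \<subseteq> X" "e \<notin> X" by auto
  moreover from this have "X = - {e}" by auto
  ultimately show ?thesis by simp
qed

text \<open>
Otherwise all neighbours of \<open>v\<close> would be \<open>w\<close>, and deleting \<open>w\<close> would isolate \<open>v\<close>.
\<close>

lemma star_not_subset_star:
  assumes tc: "three_connected G" and or: "orientation_of \<omega> G" and "v \<noteq> w"
  shows "\<not> star \<omega> v \<subseteq> star \<omega> w"
proof
  assume sub: "star \<omega> v \<subseteq> star \<omega> w"
  have "card {v, w} \<le> 3"
    by (simp add: card_insert_if)
  then obtain z where z: "z \<notin> {v, w}"
    by (rule vertex_outside[OF tc])
  have av: "v \<notin> {w}" "z \<notin> {w}" "card {w} < 3"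
    using z \<open>v \<noteq> w\<close> by auto
  obtain r where r: "integer_vector r" "boundary \<omega> r = axis z 1 - axis v 1"
    "\<forall>e\<in>support r. fst (\<omega> e) \<notin> {w} \<and> snd (\<omega> e) \<notin> {w}"
    by (rule route[OF tc or av(3,1,2)])
  have "support r \<inter> star \<omega> v = {}"
    using r(3) sub by (auto simp: star_def)
  then have "boundary \<omega> r $ v = 0"
    unfolding boundary_component by (intro sum.neutral) (auto simp: star_def support_def)
  then show False
    using r(2) z by (auto simp: axis_def split: if_splits)
qed

lemma star_nonempty:
  assumes tc: "three_connected G" and or: "orientation_of \<omega> G"
  shows "star \<omega> v \<noteq> {}"
proof -
  obtain z where z: "z \<noteq> v"
    using vertex_outside[OF tc, of "{v}"] by auto
  then show ?thesis
    using star_not_subset_star[OF tc or, of v z] by auto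
qed

lemma UNIV_is_flow_support:
  fixes G :: "('v::finite, 'e::finite) multigraph"
  assumes tc: "three_connected G" and or: "orientation_of \<omega> G"
  shows "UNIV \<in> flow_supports \<omega>"
proof -
  have "card {undefined :: 'v} \<le> 3"
    by simp
  then obtain w where "w \<notin> {undefined :: 'v}"
    by (rule vertex_outside[OF tc])
  then have w: "w \<noteq> undefined"
    by simp
  obtain e where e: "e \<in> star \<omega> w" "e \<notin> star \<omega> undefined"
    using star_not_subset_star[OF tc or w] by (auto simp: subset_iff)
  obtain f where f: "f \<in> star \<omega> undefined"
    using star_nonempty[OF tc or] by (metis ex_in_conv)
  have "f \<noteq> e"
    using e f by metis
  then have "- {e} \<union> - {f} = UNIV" by auto
  then show ?thesis
    using flow_supports_Un complement_singleton_is_flow_support[OF tc or] by metis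
qed

text \<open>
The other ends of \<open>f\<close> and \<open>g\<close> stay connected when \<open>u\<close> and \<open>X\<close>, at most two vertices, are deleted; they may coincide.
Close the walk between them through \<open>u\<close>.
\<close>

lemma circuit_through_two_edges_at_vertex:
  assumes tc: "three_connected G" and or: "orientation_of \<omega> G" and "card X < 2"
    and "f \<noteq> g" "f \<in> star \<omega> u" "g \<in> star \<omega> u"
    and av: "\<forall>x\<in>X. f \<notin> star \<omega> x \<and> g \<notin> star \<omega> x"
  obtains C where "C \<in> flow_supports \<omega>" "C \<inter> star \<omega> u = {f, g}"
    "\<forall>x\<in>X. C \<inter> star \<omega> x = {}"
proof -
  define other where "other e = (if fst (\<omega> e) = u then snd (\<omega> e) else fst (\<omega> e))" for e
  define s :: "_ \<Rightarrow> real" where "s e = (if fst (\<omega> e) = u then 1 else - 1)" for e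
  have bd: "boundary \<omega> (axis e (s e)) = axis (other e) 1 - axis u 1" if "e \<in> star \<omega> u" for e
    using that by (auto simp: boundary_axis s_def other_def star_def)
  have "other e \<notin> insert u X" if "e \<in> star \<omega> u" "\<And>x. x \<in> X \<Longrightarrow> e \<notin> star \<omega> x" for e
    using that loopless[OF tc or, of e] by (auto simp: other_def star_def)
  then have out: "other f \<notin> insert u X" "other g \<notin> insert u X"
    using av assms(5,6) by blast+
  have small: "card (insert u X) < 3"
    using \<open>card X < 2\<close> by (simp add: card_insert_if)
  obtain r where r: "integer_vector r" "boundary \<omega> r = axis (other g) 1 - axis (other f) 1"
    "\<forall>e\<in>support r. fst (\<omega> e) \<notin> insert u X \<and> snd (\<omega> e) \<notin> insert u X"
    by (rule route[OF tc or small out(1,2)])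
  let ?c = "r + axis f (s f) - axis g (s g)"
  have "s e \<in> \<int>" for e by (simp add: s_def)
  then have "integer_vector ?c"
    using r(1) by (simp add: integer_vector_add integer_vector_diff integer_vector_axis)
  moreover have "boundary \<omega> ?c = 0"
    using r(2) bd assms(5,6)
    by (simp add: matrix_vector_right_distrib matrix_vector_mult_diff_distrib)
  ultimately have "support ?c \<in> flow_supports \<omega>"
    by (simp add: flow_supports_def flow_lattice_iff)
  moreover have rs: "support r \<inter> star \<omega> x = {}" if "x \<in> insert u X" for x
    using r(3) that by (auto simp: star_def)
  moreover have nz: "f \<notin> support r" "g \<notin> support r"
    using rs[of u] assms(5,6) by auto
  moreover have "support ?c = insert f (insert g (support r))"
    using nz \<open>f \<noteq> g\<close> by (auto simp: support_def axis_def s_def)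
  ultimately show ?thesis
    using that[of "support ?c"] av assms(5,6) by auto
qed

section \<open>Recovering the vertex stars\<close>

text \<open>
For matroids, the minimal nonempty sets that meet no circuit in exactly one element are the cocircuits.  Phrased
with the supports of flows in place of circuits, the property is transported by \<open>\<sigma>\<close>.
\<close>

definition cocyclic :: "('e::finite \<Rightarrow> 'v::finite \<times> 'v) \<Rightarrow> 'e set \<Rightarrow> bool" where
  "cocyclic \<omega> D \<longleftrightarrow> (\<forall>C\<in>flow_supports \<omega>. \<forall>e. C \<inter> D \<noteq> {e})"

lemma cocyclic_edge_cut: "cocyclic \<omega> (edge_cut \<omega> S)"
  unfolding cocyclic_def flow_supports_def
proof safe
  fix x e
  assume x: "x \<in> flow_lattice \<omega>" and e: "support x \<inter> edge_cut \<omega> S = {e}"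
  have "(of_bool (snd (\<omega> e) \<in> S) - of_bool (fst (\<omega> e) \<in> S)) * x $ e = 0"
    using x sum_boundary_edge_cut[of \<omega> x S] by (simp add: e flow_lattice_iff)
  moreover have "x $ e \<noteq> 0" "e \<in> edge_cut \<omega> S"
    using e by (auto simp: support_def)
  ultimately show False
    by (auto simp: edge_cut_def)
qed

text \<open>
Deleting \<open>D\<close> separates the two ends of \<open>e\<close>, because a walk between them that avoids \<open>D\<close> could be closed up by \<open>e\<close> and
would then meet \<open>D\<close> in \<open>e\<close> alone.  Take for \<open>S\<close> what remains connected to one end.
\<close>

lemma cocyclic_contains_edge_cut:
  assumes D: "cocyclic \<omega> D" and e: "e \<in> D"
  obtains S where "e \<in> edge_cut \<omega> S" "edge_cut \<omega> S \<subseteq> D"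
proof -
  define a where "a = fst (\<omega> e)"
  define S where "S = {z. \<exists>r. integer_vector r \<and> boundary \<omega> r = axis z 1 - axis a 1 \<and> support r \<inter> D = {}}"
  have a: "a \<in> S"
    unfolding S_def by (auto simp: integer_vector_def support_def intro!: exI[of _ 0])
  have "snd (\<omega> e) \<notin> S"
  proof
    assume "snd (\<omega> e) \<in> S"
    then obtain r where r: "integer_vector r" "boundary \<omega> r = axis (snd (\<omega> e)) 1 - axis a 1"
      "support r \<inter> D = {}"
      by (auto simp: S_def)
    then have "axis e 1 - r \<in> flow_lattice \<omega>"
      by (simp add: flow_lattice_iff integer_vector_diff integer_vector_axis boundary_axis a_def
          matrix_vector_mult_diff_distrib)
    moreover have "r $ g = 0" if "g \<in> D" for g
      using r(3) that by (auto simp: support_def)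
    then have "support (axis e 1 - r) \<inter> D = {e}"
      using e by (auto simp: support_def axis_def)
    ultimately show False
      using D by (auto simp: cocyclic_def flow_supports_def)
  qed
  then have e_cut: "e \<in> edge_cut \<omega> S"
    using a by (simp add: edge_cut_def a_def)
  have extend: "z' \<in> S" if z: "z \<in> S" and g: "g \<notin> D" and zz: "\<omega> g = (z, z') \<or> \<omega> g = (z', z)" for z z' g
  proof -
    obtain r where r: "integer_vector r" "boundary \<omega> r = axis z 1 - axis a 1" "support r \<inter> D = {}"
      using z by (auto simp: S_def)
    define s :: real where "s = (if \<omega> g = (z, z') then 1 else - 1)"
    have "boundary \<omega> (r + axis g s) = axis z' 1 - axis a 1"
      using zz r(2) by (auto simp: matrix_vector_right_distrib boundary_axis s_def)
    moreover have "integer_vector (r + axis g s)"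
      using r(1) by (simp add: integer_vector_add integer_vector_axis s_def)
    moreover have "support (r + axis g s) \<inter> D = {}"
      using r(3) g by (auto simp: support_def axis_def)
    ultimately show ?thesis
      unfolding S_def by blast
  qed
  have "edge_cut \<omega> S \<subseteq> D"
  proof
    fix g assume g: "g \<in> edge_cut \<omega> S"
    show "g \<in> D"
    proof (rule ccontr)
      assume "g \<notin> D"
      then show False
        using g extend[of "fst (\<omega> g)" g "snd (\<omega> g)"] extend[of "snd (\<omega> g)" g "fst (\<omega> g)"]
        by (auto simp: edge_cut_def)
    qed
  qed
  with e_cut show ?thesis
    by (rule that)
qed

text \<open>
Any two edges at \<open>v\<close> lie on a cycle through \<open>v\<close>, which meets the star of \<open>v\<close> in these two edges only; so a
cocyclic set inside the star contains both or none of them.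
\<close>

lemma star_minimal_cocyclic:
  fixes G :: "('v::finite, 'e::finite) multigraph"
  assumes tc: "three_connected G" and or: "orientation_of \<omega> G"
    and D: "cocyclic \<omega> D" "D \<noteq> {}" "D \<subseteq> star \<omega> v"
  shows "D = star \<omega> v"
proof (rule ccontr)
  assume "D \<noteq> star \<omega> v"
  then obtain f g where fg: "f \<in> star \<omega> v" "f \<notin> D" "g \<in> star \<omega> v" "g \<in> D"
    using D by blast
  have neq: "f \<noteq> g"
    using fg by auto
  have none: "card ({} :: 'v set) < 2" "\<forall>x\<in>{}. f \<notin> star \<omega> x \<and> g \<notin> star \<omega> x"
    by simp_all
  obtain C where C: "C \<in> flow_supports \<omega>" "C \<inter> star \<omega> v = {f, g}"
    "\<forall>x\<in>{}. C \<inter> star \<omega> x = {}"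
    by (rule circuit_through_two_edges_at_vertex[OF tc or none(1) neq fg(1,3) none(2)])
  have "C \<inter> D = C \<inter> star \<omega> v \<inter> D"
    using Int_absorb1[OF D(3)] by (simp add: Int_assoc)
  also have "\<dots> = {g}"
    unfolding C(2) using fg by auto
  finally show False
    using D(1) C(1) by (simp add: cocyclic_def)
qed

lemma flow_support_restrict_side:
  assumes C: "C \<in> flow_supports \<omega>" and "C \<inter> edge_cut \<omega> S = {}"
  shows "C \<inter> {e. fst (\<omega> e) \<in> S \<and> snd (\<omega> e) \<in> S} \<in> flow_supports \<omega>"
proof -
  let ?A = "{e. fst (\<omega> e) \<in> S \<and> snd (\<omega> e) \<in> S}"
  obtain x where x: "x \<in> flow_lattice \<omega>" "C = support x"
    using C by (auto simp: flow_supports_def)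
  define y where "y = (\<chi> e. if e \<in> ?A then x $ e else 0)"
  have off: "x $ e = 0" if "(fst (\<omega> e) \<in> S) \<noteq> (snd (\<omega> e) \<in> S)" for e
    using that assms(2) x(2) by (auto simp: support_def edge_cut_def)
  have "boundary \<omega> y $ v = (if v \<in> S then boundary \<omega> x $ v else 0)" for v
  proof -
    let ?i = "\<lambda>e. of_bool (snd (\<omega> e) = v) - of_bool (fst (\<omega> e) = v) :: real"
    have "?i e * y $ e = (if v \<in> S then ?i e * x $ e else 0)" for e
      using off[of e] by (cases "x $ e = 0") (auto simp: y_def)
    then show ?thesis
      by (simp add: boundary_component)
  qed
  then have "boundary \<omega> y = 0"
    using x(1) by (simp add: vec_eq_iff flow_lattice_iff)
  moreover have "integer_vector y"
    using x(1) by (simp add: flow_lattice_iff integer_vector_def y_def)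
  moreover have "support y = C \<inter> ?A"
    by (auto simp: x(2) support_def y_def)
  ultimately show ?thesis
    by (metis flow_lattice_iff flow_supports_def imageI)
qed

text \<open>
Deleting \<open>v\<close> leaves a 2-connected graph, whose cycle matroid is connected: \<open>A\<close> and \<open>B\<close> share a vertex \<open>u\<close>, as the graph without \<open>v\<close> is
connected, and a cycle through \<open>u\<close> that enters by \<open>A\<close> and leaves by \<open>B\<close> does not split along \<open>A\<close> and \<open>B\<close>.
\<close>

lemma vertex_deletion_inseparable:
  assumes tc: "three_connected G" and or: "orientation_of \<omega> G"
    and AB: "A \<union> B = - star \<omega> v" "A \<inter> B = {}" "A \<noteq> {}" "B \<noteq> {}"
  obtains C where "C \<in> flow_supports \<omega>" "C \<inter> star \<omega> v = {}" "C \<inter> A \<notin> flow_supports \<omega>"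
proof -
  have "\<exists>u a b. a \<in> A \<and> b \<in> B \<and> a \<in> star \<omega> u \<and> b \<in> star \<omega> u"
  proof (rule ccontr)
    assume none: "\<not> ?thesis"
    define T where "T = {u. \<exists>a\<in>A. a \<in> star \<omega> u}"
    obtain a b where ab: "a \<in> A" "b \<in> B"
      using AB by blast
    then have p: "fst (\<omega> a) \<in> T" "fst (\<omega> b) \<notin> T"
      using none by (auto simp: T_def star_def)
    have "a \<notin> star \<omega> v" "b \<notin> star \<omega> v"
      using ab AB(1) by auto
    then have av: "fst (\<omega> a) \<notin> {v}" "fst (\<omega> b) \<notin> {v}" "card {v} < 3"
      by (auto simp: star_def)
    obtain r where r: "integer_vector r" "boundary \<omega> r = axis (fst (\<omega> b)) 1 - axis (fst (\<omega> a)) 1"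
      "\<forall>e\<in>support r. fst (\<omega> e) \<notin> {v} \<and> snd (\<omega> e) \<notin> {v}"
      by (rule route[OF tc or av(3,1,2)])
    have "e \<notin> edge_cut \<omega> T" if "e \<in> support r" for e
    proof -
      have "e \<in> A \<union> B"
        using r(3) that AB(1) by (auto simp: star_def)
      then show ?thesis
        using none by (auto simp: T_def star_def edge_cut_def)
    qed
    then have "support r \<inter> edge_cut \<omega> T = {}"
      by blast
    then have "(\<Sum>u\<in>T. boundary \<omega> r $ u) = 0"
      unfolding sum_boundary_edge_cut by (simp only: sum.empty)
    moreover have "(\<Sum>u\<in>T. boundary \<omega> r $ u) = - 1"
      using p by (simp add: r(2) sum_subtractf axis_def)
    ultimately show False
      by simp
  qed
  then obtain u a b where uab: "a \<in> A" "b \<in> B" "a \<in> star \<omega> u" "b \<in> star \<omega> u"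
    by blast
  have off: "\<forall>x\<in>{v}. a \<notin> star \<omega> x \<and> b \<notin> star \<omega> x" and ab: "a \<noteq> b" and one: "card {v} < 2"
    using uab AB by auto
  obtain C where C: "C \<in> flow_supports \<omega>" "C \<inter> star \<omega> u = {a, b}"
    "\<forall>x\<in>{v}. C \<inter> star \<omega> x = {}"
    by (rule circuit_through_two_edges_at_vertex[OF tc or one ab uab(3,4) off])
  have "C \<inter> A \<inter> star \<omega> u = {a}"
    using C(2) uab AB(2) by auto
  moreover have "cocyclic \<omega> (star \<omega> u)"
    using cocyclic_edge_cut star_eq_edge_cut loopless[OF tc or] by metis
  ultimately have "C \<inter> A \<notin> flow_supports \<omega>"
    by (auto simp: cocyclic_def)
  then show ?thesis
    using C(1,3) that by simp
qed

text \<open>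
The image of the star is a minimal cut.  Minimality leaves two possibilities: it is a star, or it contains no star,
so that every vertex has an edge on its own side of the cut and the complement of the cut falls apart into two nonempty
pieces that share no cycle.  The second contradicts \<open>vertex_deletion_inseparable\<close>.
\<close>

lemma star_image_is_star:
  fixes G :: "('v::finite, 'e::finite) multigraph" and H :: "('w::finite, 'f::finite) multigraph"
  assumes G: "three_connected G" "orientation_of \<omega> G"
    and H: "three_connected H" "orientation_of \<eta> H"
    and \<sigma>: "bij \<sigma>" "\<And>X. \<sigma> ` X \<in> flow_supports \<eta> \<longleftrightarrow> X \<in> flow_supports \<omega>"
  shows "\<exists>w. \<sigma> ` star \<omega> v = star \<eta> w"
proof -
  let ?D = "\<sigma> ` star \<omega> v"
  have inj: "inj \<sigma>" and surj: "surj \<sigma>"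
    using \<sigma>(1) by (auto simp: bij_def)
  have coc_star: "cocyclic \<eta> (star \<eta> w)" for w
    using cocyclic_edge_cut star_eq_edge_cut loopless[OF H] by metis
  have coc: "cocyclic \<eta> (\<sigma> ` D) \<longleftrightarrow> cocyclic \<omega> D" for D
  proof
    assume D: "cocyclic \<eta> (\<sigma> ` D)"
    show "cocyclic \<omega> D"
      unfolding cocyclic_def
    proof (intro ballI allI notI)
      fix C e assume C: "C \<in> flow_supports \<omega>" "C \<inter> D = {e}"
      then have "\<sigma> ` C \<inter> \<sigma> ` D = {\<sigma> e}"
        by (simp add: image_Int[OF inj, symmetric])
      moreover have "\<sigma> ` C \<in> flow_supports \<eta>"
        using C(1) by (simp add: \<sigma>(2))
      ultimately show False
        using D by (simp add: cocyclic_def)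
    qed
  next
    assume D: "cocyclic \<omega> D"
    show "cocyclic \<eta> (\<sigma> ` D)"
      unfolding cocyclic_def
    proof (intro ballI allI notI)
      fix C' f assume C': "C' \<in> flow_supports \<eta>" "C' \<inter> \<sigma> ` D = {f}"
      define C where "C = \<sigma> -` C'"
      have C: "C' = \<sigma> ` C"
        using surj by (simp add: C_def surj_image_vimage_eq)
      obtain e where e: "f = \<sigma> e"
        using surj by (rule surjE)
      have "\<sigma> ` (C \<inter> D) = \<sigma> ` {e}"
        using C'(2) by (simp add: C e image_Int[OF inj])
      then have "C \<inter> D = {e}"
        by (simp only: inj_image_eq_iff[OF inj])
      moreover have "C \<in> flow_supports \<omega>"
        using C'(1) by (simp add: C \<sigma>(2))
      ultimately show False
        using D by (simp add: cocyclic_def)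
    qed
  qed
  have minimal: "D' = ?D" if D': "cocyclic \<eta> D'" "D' \<noteq> {}" "D' \<subseteq> ?D" for D'
  proof -
    obtain D where D: "D' = \<sigma> ` D" "D \<subseteq> star \<omega> v"
      using D'(3) by (auto simp: subset_image_iff)
    then show ?thesis
      using star_minimal_cocyclic[OF G, of D v] D' coc by auto
  qed
  have "cocyclic \<omega> (star \<omega> v)"
    using cocyclic_edge_cut star_eq_edge_cut loopless[OF G] by metis
  then have "cocyclic \<eta> ?D"
    by (simp add: coc)
  moreover obtain e where e: "e \<in> ?D"
    using star_nonempty[OF G, of v] by auto
  ultimately obtain S where S: "e \<in> edge_cut \<eta> S" "edge_cut \<eta> S \<subseteq> ?D"
    using cocyclic_contains_edge_cut by metis
  then have D: "?D = edge_cut \<eta> S"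
    using minimal[OF cocyclic_edge_cut] by auto
  show ?thesis
  proof (rule ccontr)
    assume no: "\<nexists>w. ?D = star \<eta> w"
    have inner: "\<exists>f\<in>star \<eta> w. f \<notin> edge_cut \<eta> S" for w
    proof (rule ccontr)
      assume "\<not> ?thesis"
      then have "star \<eta> w \<subseteq> ?D"
        unfolding D by blast
      then have "star \<eta> w = ?D"
        using minimal[OF coc_star] star_nonempty[OF H] by blast
      then show False
        using no by metis
    qed
    define A' where "A' = {f. fst (\<eta> f) \<in> S \<and> snd (\<eta> f) \<in> S}"
    define B' where "B' = {f. fst (\<eta> f) \<notin> S \<and> snd (\<eta> f) \<notin> S}"
    obtain p q where pq: "p \<in> S" "q \<notin> S"
      using S(1) by (auto simp: edge_cut_def)
    have "A' \<noteq> {}" "B' \<noteq> {}"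
      using inner[of p] inner[of q] pq by (auto simp: A'_def B'_def star_def edge_cut_def)
    moreover have "A' \<union> B' = - ?D" "A' \<inter> B' = {}"
      unfolding D by (auto simp: A'_def B'_def edge_cut_def)
    ultimately have "\<sigma> -` A' \<union> \<sigma> -` B' = - star \<omega> v" "\<sigma> -` A' \<inter> \<sigma> -` B' = {}"
      "\<sigma> -` A' \<noteq> {}" "\<sigma> -` B' \<noteq> {}"
      using inj surj
      by (auto simp: vimage_Un[symmetric] vimage_Int[symmetric] vimage_Compl inj_vimage_image_eq surj_vimage_empty)
    then obtain C where C: "C \<in> flow_supports \<omega>" "C \<inter> star \<omega> v = {}" "C \<inter> \<sigma> -` A' \<notin> flow_supports \<omega>"
      using vertex_deletion_inseparable[OF G] by metis
    have "\<sigma> ` C \<in> flow_supports \<eta>"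
      using C(1) \<sigma>(2) by blast
    moreover have "\<sigma> ` C \<inter> edge_cut \<eta> S = {}"
      using C(2) by (simp add: D[symmetric] image_Int[OF inj, symmetric])
    ultimately have "\<sigma> ` C \<inter> A' \<in> flow_supports \<eta>"
      unfolding A'_def by (rule flow_support_restrict_side)
    moreover have "\<sigma> ` C \<inter> A' = \<sigma> ` (C \<inter> \<sigma> -` A')"
      by auto
    ultimately show False
      using C(3) \<sigma>(2) by simp
  qed
qed

text \<open>
The ends of an edge are the vertices whose stars contain it, so a bijection of the edges that matches
the stars of one graph with those of the other comes from an isomorphism.
\<close>

theorem whitney_flow_supports:
  fixes G :: "('v::finite, 'e::finite) multigraph" and H :: "('w::finite, 'f::finite) multigraph"
  assumes G: "three_connected G" "orientation_of \<omega> G"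
    and H: "three_connected H" "orientation_of \<eta> H"
    and \<sigma>: "bij \<sigma>" "\<And>X. \<sigma> ` X \<in> flow_supports \<eta> \<longleftrightarrow> X \<in> flow_supports \<omega>"
  shows "isomorphic_graphs G H"
proof -
  have inj: "inj \<sigma>" and surj: "surj \<sigma>"
    using \<sigma>(1) by (auto simp: bij_def)
  obtain \<alpha> where \<alpha>: "\<And>v. \<sigma> ` star \<omega> v = star \<eta> (\<alpha> v)"
    using star_image_is_star[OF G H \<sigma>] by metis
  have \<tau>: "bij (inv \<sigma>)" "\<And>X. inv \<sigma> ` X \<in> flow_supports \<omega> \<longleftrightarrow> X \<in> flow_supports \<eta>"
    using \<sigma> bij_imp_bij_inv by (auto simp: image_f_inv_f surj \<sigma>(2)[symmetric])
  have "inj \<alpha>"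
    by (rule injI) (metis \<alpha> inj inj_image_eq_iff star_not_subset_star[OF G] order_refl)
  have "surj \<alpha>"
  proof -
    have "\<exists>v. \<alpha> v = w" for w
    proof -
      obtain v where "inv \<sigma> ` star \<eta> w = star \<omega> v"
        using star_image_is_star[OF H G \<tau>] by metis
      then have "star \<eta> (\<alpha> v) = star \<eta> w"
        by (metis \<alpha> image_f_inv_f surj)
      then show ?thesis
        using star_not_subset_star[OF H] by (metis order_refl)
    qed
    then show ?thesis
      by (metis surjI)
  qed
  with \<open>inj \<alpha>\<close> have "bij \<alpha>"
    by (simp add: bij_def)
  moreover have "H (\<sigma> e) = map_uprod \<alpha> (G e)" for e
  proof -
    have "\<sigma> e \<in> star \<eta> (\<alpha> v) \<longleftrightarrow> e \<in> star \<omega> v" for v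
      by (metis \<alpha> inj inj_image_mem_iff)
    then have "\<alpha> -` {fst (\<eta> (\<sigma> e)), snd (\<eta> (\<sigma> e))} = {fst (\<omega> e), snd (\<omega> e)}"
      unfolding star_def by (simp add: set_eq_iff)
    then have "{fst (\<eta> (\<sigma> e)), snd (\<eta> (\<sigma> e))} = \<alpha> ` {fst (\<omega> e), snd (\<omega> e)}"
      using \<open>surj \<alpha>\<close> by (metis surj_image_vimage_eq)
    then show ?thesis
      using G(2) H(2) by (auto simp: orientation_of_def doubleton_eq_iff)
  qed
  ultimately show ?thesis
    using \<sigma>(1) unfolding isomorphic_graphs_def by blast
qed

section \<open>Isomorphic graphs have isometric flow lattices\<close>

lemma isomorphic_imp_isometric:
  fixes G :: "('v::finite, 'e::finite) multigraph" and H :: "('w::finite, 'f::finite) multigraph"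
  assumes or: "orientation_of \<omega> G" "orientation_of \<eta> H" and iso: "isomorphic_graphs G H"
  shows "isometric_lattices (flow_lattice \<omega>) (flow_lattice \<eta>)"
proof -
  obtain \<alpha> :: "'v \<Rightarrow> 'w" and \<beta> :: "'e \<Rightarrow> 'f"
    where \<alpha>: "bij \<alpha>" and \<beta>: "bij \<beta>" and GH: "\<And>e. H (\<beta> e) = map_uprod \<alpha> (G e)"
    using iso by (auto simp: isomorphic_graphs_def)
  have injb: "inj \<beta>" and surjb: "surj \<beta>" and inja: "inj \<alpha>" and surja: "surj \<alpha>"
    using \<alpha> \<beta> by (auto simp: bij_def)
  \<comment> \<open>The sign records whether \<open>\<beta>\<close> reverses the orientation of the edge.\<close>
  define s :: "'e \<Rightarrow> real" where "s e = (if fst (\<eta> (\<beta> e)) = \<alpha> (fst (\<omega> e)) then 1 else - 1)" for e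
  have ss: "s e * s e = 1" "s e \<in> \<int>" for e
    by (auto simp: s_def)
  define \<psi> :: "real ^ 'e \<Rightarrow> real ^ 'f" where "\<psi> x = (\<chi> f. s (inv \<beta> f) * x $ inv \<beta> f)" for x
  define \<phi> :: "real ^ 'f \<Rightarrow> real ^ 'e" where "\<phi> y = (\<chi> e. s e * y $ \<beta> e)" for y
  have \<psi>: "\<psi> x $ \<beta> e = s e * x $ e" for x e
    by (simp add: \<psi>_def inv_f_f injb)
  have ends: "fst (\<eta> (\<beta> e)) = \<alpha> (fst (\<omega> e)) \<and> snd (\<eta> (\<beta> e)) = \<alpha> (snd (\<omega> e))
      \<or> fst (\<eta> (\<beta> e)) = \<alpha> (snd (\<omega> e)) \<and> snd (\<eta> (\<beta> e)) = \<alpha> (fst (\<omega> e))" for e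
    using GH[of e] or by (simp add: orientation_of_def)
  have bd: "boundary \<eta> (\<psi> x) $ \<alpha> v = boundary \<omega> x $ v" for x v
  proof -
    have "boundary \<eta> (\<psi> x) $ \<alpha> v = (\<Sum>e\<in>UNIV.
        (of_bool (snd (\<eta> (\<beta> e)) = \<alpha> v) - of_bool (fst (\<eta> (\<beta> e)) = \<alpha> v)) * \<psi> x $ \<beta> e)"
      unfolding boundary_component using sum.reindex_bij_betw[OF \<beta>] by (rule sym)
    also have "\<dots> = boundary \<omega> x $ v"
      unfolding boundary_component
    proof (rule sum.cong)
      fix e
      show "(of_bool (snd (\<eta> (\<beta> e)) = \<alpha> v) - of_bool (fst (\<eta> (\<beta> e)) = \<alpha> v)) * \<psi> x $ \<beta> e
        = (of_bool (snd (\<omega> e) = v) - of_bool (fst (\<omega> e) = v)) * x $ e"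
        using ends[of e] by (auto simp: \<psi> s_def inj_eq[OF inja])
    qed simp
    finally show ?thesis .
  qed
  have \<psi>\<phi>: "\<psi> (\<phi> y) = y" for y
    by (simp add: \<psi>_def \<phi>_def vec_eq_iff surj_f_inv_f[OF surjb] mult.assoc[symmetric] ss)
  have \<phi>\<psi>: "\<phi> (\<psi> x) = x" for x
    by (simp add: \<phi>_def \<psi> vec_eq_iff mult.assoc[symmetric] ss)
  have flow: "\<psi> x \<in> flow_lattice \<eta> \<longleftrightarrow> x \<in> flow_lattice \<omega>" for x
  proof -
    have "boundary \<eta> (\<psi> x) = 0 \<longleftrightarrow> boundary \<omega> x = 0"
      using surja by (auto simp: vec_eq_iff bd[symmetric]) (metis surjD)
    moreover have "integer_vector (\<psi> x)" if "integer_vector x"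
      using that ss by (simp add: integer_vector_def \<psi>_def)
    moreover have "integer_vector x" if "integer_vector (\<psi> x)"
    proof -
      have "integer_vector (\<phi> (\<psi> x))"
        using that ss by (simp add: integer_vector_def \<phi>_def)
      then show ?thesis by (simp add: \<phi>\<psi>)
    qed
    ultimately show ?thesis
      by (auto simp: flow_lattice_iff)
  qed
  have bij: "bij_betw \<psi> (flow_lattice \<omega>) (flow_lattice \<eta>)"
    using flow \<psi>\<phi> \<phi>\<psi> by (intro bij_betw_byWitness[of _ \<phi>]) (auto, metis)
  have add: "\<psi> (x + y) = \<psi> x + \<psi> y" for x y
    by (simp add: \<psi>_def vec_eq_iff distrib_left)
  have dot: "\<psi> x \<bullet> \<psi> y = x \<bullet> y" for x y
  proof -
    have "\<psi> x \<bullet> \<psi> y = (\<Sum>e\<in>UNIV. \<psi> x $ \<beta> e * \<psi> y $ \<beta> e)"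
      unfolding inner_vec_def inner_real_def using sum.reindex_bij_betw[OF \<beta>] by (rule sym)
    also have "\<dots> = (\<Sum>e\<in>UNIV. (s e * s e) * (x $ e * y $ e))"
      by (rule sum.cong) (simp_all add: \<psi> mult_ac)
    finally show ?thesis
      by (simp add: ss inner_vec_def)
  qed
  have inv: "inv_into (flow_lattice \<omega>) \<psi> y = \<phi> y" if "y \<in> flow_lattice \<eta>" for y
    using bij that \<psi>\<phi> \<phi>\<psi> by (metis bij_betw_inv_into_right)
  have \<phi>_flow: "\<phi> y \<in> flow_lattice \<omega>" if "y \<in> flow_lattice \<eta>" for y
    using flow[of "\<phi> y"] that by (simp add: \<psi>\<phi>)
  have "\<phi> (x + y) = \<phi> x + \<phi> y" "\<phi> x \<bullet> \<phi> y = x \<bullet> y" for x y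
    by (metis add \<psi>\<phi> \<phi>\<psi>) (metis dot \<psi>\<phi>)
  then have "lattice_isometry \<psi> (flow_lattice \<omega>) (flow_lattice \<eta>)"
    using bij add dot flow inv \<phi>_flow
    by (auto simp: lattice_isometry_def lattice_morphism_def flow_lattice_add)
  then show ?thesis
    by (auto simp: isometric_lattices_def)
qed

section \<open>The flow lattice determines a 3-connected graph\<close>

theorem corollary2:
  fixes G :: "('v::finite, 'e::finite) multigraph"
    and H :: "('w::finite, 'f::finite) multigraph"
    and \<omega>\<^sub>G :: "'e \<Rightarrow> 'v \<times> 'v"
    and \<omega>\<^sub>H :: "'f \<Rightarrow> 'w \<times> 'w"
  assumes "three_connected G"
    and "three_connected H"
    and "orientation_of \<omega>\<^sub>G G"
    and "orientation_of \<omega>\<^sub>H H"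
  shows "isometric_lattices (flow_lattice \<omega>\<^sub>G) (flow_lattice \<omega>\<^sub>H) \<longleftrightarrow> isomorphic_graphs G H"
proof
  assume "isometric_lattices (flow_lattice \<omega>\<^sub>G) (flow_lattice \<omega>\<^sub>H)"
  then obtain \<psi> where "lattice_isometry \<psi> (flow_lattice \<omega>\<^sub>G) (flow_lattice \<omega>\<^sub>H)"
    by (auto simp: isometric_lattices_def)
  then obtain \<sigma> where "bij \<sigma>" "\<And>X. \<sigma> ` X \<in> flow_supports \<omega>\<^sub>H \<longleftrightarrow> X \<in> flow_supports \<omega>\<^sub>G"
    using isometry_induces_edge_bijection assms complement_singleton_is_flow_support
      UNIV_is_flow_support by metis
  then show "isomorphic_graphs G H"
    using whitney_flow_supports assms by metis
next
  assume "isomorphic_graphs G H"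
  then show "isometric_lattices (flow_lattice \<omega>\<^sub>G) (flow_lattice \<omega>\<^sub>H)"
    using isomorphic_imp_isometric assms by metis
qed

end
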